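(* Let $X$ be a Banach space and let $T,K\in B[X]$. If $T$ is left semi-Fredholm and $K$ is compact, then $\overline{\mathcal R(T+K)}$ and $\mathcal N(T+K)$ are complemented subspaces of $X$, $\overline{\mathcal R(T^*+K^* )}$ and $\mathcal N(T^*+K^* )$ are complemented subspaces of $X^*$, and both $T+K$ and $T^*+K^*$ have closed range (in $X$ and $X^*$, respectively).
   Context: For a normed space $Y$, $B[Y]$ is the algebra of bounded linear operators on $Y$; a subspace of $Y$ means a norm-closed linear manifold of $Y$. A subspace $M$ of $Y$ is complemented in $Y$ if there is a subspace (norm-closed linear manifold) $N$ of $Y$ with $M+N=Y$ and $M\cap N=\{0\}$. For an operator $S$, $\mathcal R(S)$ and $\mathcal N(S)$ denote its range and kernel, and $\overline{\mathcal R(S)}$ is the norm closure of the range. $X^*$ is the (norm) dual of $X$, and the normed-space adjoint $T^*\in B[X^*]$ of $T\in B[X]$ is given by $T^*f=f\circ T$. An operator $T\in B[X]$ on a Banach space $X$ is left semi-Fredholm if it is left essentially invertible, i.e., there exist $S\in B[X]$ and a compact $C\in B[X]$ with $ST=I+C$. *)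

theory Defs
  imports "HOL-Analysis.Analysis"
begin

text \<open>
  The theory of a Banach space over \<open>\<real>\<close> or over \<open>\<complex>\<close>. The library only has real normed spaces
  as a type class, so the scalar field is a type \<open>'k\<close> of class
  \<open>{real_normed_field,euclidean_space}\<close>: a finite-dimensional field extension of \<open>\<real>\<close> whose norm is
  multiplicative. By the theorem of Frobenius the only such fields are \<open>\<real>\<close> and \<open>\<complex>\<close> with their absolute
  values, and both are instances. A Banach space over \<open>'k\<close> is a real Banach space together
  with a compatible multiplication by the scalars in \<open>'k\<close>.
\<close>

locale banach_space_over = vector_space smul
  for smul :: "'k::{real_normed_field,euclidean_space} \<Rightarrow> 'a::banach \<Rightarrow> 'a" +
  assumes smul_of_real: "smul (of_real r) x = r *\<^sub>R x"
    and norm_smul: "norm (smul c x) = norm c * norm x"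

lemma banach_space_over_real: "banach_space_over ((*\<^sub>R) :: real \<Rightarrow> 'a::banach \<Rightarrow> 'a)"
  by unfold_locales (auto simp: algebra_simps)

lemma banach_space_over_complex: "banach_space_over ((*) :: complex \<Rightarrow> complex \<Rightarrow> complex)"
  by unfold_locales (auto simp: algebra_simps norm_mult scaleR_conv_of_real)

text \<open>\<open>B[X]\<close>: the type \<open>'a \<Rightarrow>\<^sub>L 'a\<close> consists of all bounded real-linear operators,
  of which only the \<open>'k\<close>-linear ones belong to \<open>B[X]\<close>.\<close>

definition bounded_operators ::
    "('k::{real_normed_field,euclidean_space} \<Rightarrow> 'a::banach \<Rightarrow> 'a) \<Rightarrow> ('a \<Rightarrow>\<^sub>L 'a) set" where
  "bounded_operators smul = {T. \<forall>c x. blinfun_apply T (smul c x) = smul c (blinfun_apply T x)}"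

definition compact_operator :: "('a::real_normed_vector \<Rightarrow>\<^sub>L 'b::real_normed_vector) \<Rightarrow> bool" where
  "compact_operator C \<longleftrightarrow> (\<forall>B. bounded B \<longrightarrow> compact (closure (blinfun_apply C ` B)))"

definition left_semi_Fredholm ::
    "('k::{real_normed_field,euclidean_space} \<Rightarrow> 'a::banach \<Rightarrow> 'a) \<Rightarrow> ('a \<Rightarrow>\<^sub>L 'a) \<Rightarrow> bool" where
  "left_semi_Fredholm smul T \<longleftrightarrow>
     T \<in> bounded_operators smul \<and>
     (\<exists>S \<in> bounded_operators smul. \<exists>C \<in> bounded_operators smul.
        compact_operator C \<and> S o\<^sub>L T = id_blinfun + C)"

text \<open>
  The dual \<open>X\<^sup>*\<close> of \<open>X\<close> is the set of \<open>'k\<close>-linear elements of the normed space \<open>'a \<Rightarrow>\<^sub>L 'k\<close> of bounded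
  real-linear maps, with the induced norm (the usual dual norm) and the
  multiplication \<open>(c f)(x) = c f(x)\<close>. For real scalars it is the whole type.
\<close>

definition dual_space ::
    "('k::{real_normed_field,euclidean_space} \<Rightarrow> 'a::banach \<Rightarrow> 'a) \<Rightarrow> ('a \<Rightarrow>\<^sub>L 'k) set" where
  "dual_space smul = {f. \<forall>c x. blinfun_apply f (smul c x) = c * blinfun_apply f x}"

definition dual_scale ::
    "'k::{real_normed_field,euclidean_space} \<Rightarrow> ('a::banach \<Rightarrow>\<^sub>L 'k) \<Rightarrow> ('a \<Rightarrow>\<^sub>L 'k)" where
  "dual_scale c f = blinfun_mult_right c o\<^sub>L f"

lemma dual_scale_apply: "blinfun_apply (dual_scale c f) x = c * blinfun_apply f x"
  by (simp add: dual_scale_def)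

lemma banach_space_over_dual_scale:
  "banach_space_over (dual_scale ::
     'k::{real_normed_field,euclidean_space} \<Rightarrow> ('a::banach \<Rightarrow>\<^sub>L 'k) \<Rightarrow> ('a \<Rightarrow>\<^sub>L 'k))"
proof unfold_locales
  fix c :: 'k and f :: "'a \<Rightarrow>\<^sub>L 'k"
  have le: "norm (dual_scale d g) \<le> norm d * norm g" for d :: 'k and g :: "'a \<Rightarrow>\<^sub>L 'k"
    by (rule norm_blinfun_bound)
      (auto simp: dual_scale_apply norm_mult mult.assoc intro!: mult_left_mono norm_blinfun)
  show "norm (dual_scale c f) = norm c * norm f"
  proof (cases "c = 0")
    case True
    then show ?thesis using le[of 0 f] by simp
  next
    case False
    then have "dual_scale (inverse c) (dual_scale c f) = f"
      by (intro blinfun_eqI) (simp add: dual_scale_apply)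
    with le[of "inverse c" "dual_scale c f"] False
    have "norm c * norm f \<le> norm (dual_scale c f)"
      by (simp add: norm_inverse norm_divide field_simps)
    with le[of c f] show ?thesis by simp
  qed
qed (auto intro!: blinfun_eqI
       simp: dual_scale_apply blinfun.bilinear_simps algebra_simps scaleR_conv_of_real)

lemma closed_dual_space: "closed (dual_space smul)"
  unfolding dual_space_def by (intro closed_Collect_all closed_Collect_eq continuous_intros)

lemma subspace_dual_space: "module.subspace dual_scale (dual_space smul)"
proof -
  interpret dual: banach_space_over "dual_scale :: 'a \<Rightarrow> ('b \<Rightarrow>\<^sub>L 'a) \<Rightarrow> _"
    by (rule banach_space_over_dual_scale)
  show ?thesis
    by (auto simp: dual.subspace_def dual_space_def dual_scale_apply
        blinfun.bilinear_simps algebra_simps)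
qed

definition adjoint_operator ::
    "('a::real_normed_vector \<Rightarrow>\<^sub>L 'a) \<Rightarrow> ('a \<Rightarrow>\<^sub>L 'k::real_normed_vector) \<Rightarrow> ('a \<Rightarrow>\<^sub>L 'k)" where
  "adjoint_operator T f = f o\<^sub>L T"

lemma adjoint_operator_in_dual_space:
  "T \<in> bounded_operators smul \<Longrightarrow> f \<in> dual_space smul \<Longrightarrow>
     adjoint_operator T f \<in> dual_space smul"
  by (simp add: adjoint_operator_def bounded_operators_def dual_space_def)

text \<open>
  In the following \<open>Y\<close> is a normed space given as a linear manifold of an ambient space, so the
  topological notions are those of the subspace topology of \<open>Y\<close>; \<open>closedin\<close> includes \<open>M \<subseteq> Y\<close>.
\<close>

definition closed_subspace_of ::
    "('k::field \<Rightarrow> 'b::real_normed_vector \<Rightarrow> 'b) \<Rightarrow> 'b set \<Rightarrow> 'b set \<Rightarrow> bool" where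
  "closed_subspace_of smul Y M \<longleftrightarrow>
     closedin (top_of_set Y) M \<and> module.subspace smul M"

definition complemented_subspace_of ::
    "('k::field \<Rightarrow> 'b::real_normed_vector \<Rightarrow> 'b) \<Rightarrow> 'b set \<Rightarrow> 'b set \<Rightarrow> bool" where
  "complemented_subspace_of smul Y M \<longleftrightarrow>
     closed_subspace_of smul Y M \<and>
     (\<exists>N. closed_subspace_of smul Y N \<and> {x + y |x y. x \<in> M \<and> y \<in> N} = Y \<and> M \<inter> N = {0})"

end

theory Submission
  imports Defs
begin

text \<open>
  Put \<open>A = T + K\<close>. It suffices to find a scalar-linear bounded operator \<open>B\<close> with \<open>A B A = A\<close>, a
  generalized inverse of \<open>A\<close>. Then \<open>A B\<close> is a bounded projection onto the range of \<open>A\<close>, and \<open>B A\<close> is a bounded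
  projection with the same kernel as \<open>A\<close>; the range is therefore closed, and range and kernel are both
  complemented. The equation passes to adjoints, \<open>A\<^sup>* B\<^sup>* A\<^sup>* = A\<^sup>*\<close>, so the statements about the
  dual space follow from the same lemma, \<open>generalized_inverse_complemented\<close>, applied there.

  Existence of \<open>B\<close> (\<open>left_semi_Fredholm_generalized_inverse\<close>). By assumption \<open>S A = I + C\<close> with \<open>C\<close>
  compact; the term \<open>S K\<close> is absorbed by \<open>C\<close>. The first step improves \<open>S\<close> to an operator \<open>L\<close> with
  \<open>L A = I - R\<close>, \<open>R\<close> of finite rank (\<open>left_inverse_modulo_finite_rank\<close>). The kernels of the powers of
  \<open>F = I + C\<close> stabilize, so some power \<open>F' = F\<^sup>m = I + D\<close> satisfies \<open>\<N>(F') \<inter> \<R>(F') = {0}\<close>. The kernel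
  of \<open>F'\<close> has finite dimension, hence is the range of a bounded projection \<open>P\<close>, and \<open>F' + P\<close> is an
  injective compact perturbation of the identity. It is invertible by the Riesz theory; if \<open>G\<close>
  is its inverse, then \<open>G F' = I - G P\<close>, and \<open>F'\<close> has \<open>A\<close> as its rightmost factor.

  The second step corrects the defect. The operator \<open>E = A - A L A = A R\<close> has finite rank, and thus has
  a generalized inverse \<open>D\<close>, because finite-dimensional subspaces of \<open>X\<close> are complemented
  (\<open>finite_dimensional_section\<close>). Then \<open>B = L + (I - L A) D (I - A L)\<close> satisfies
  \<open>A B A = A L A + E D E = A\<close>.

  The complements of finite-dimensional subspaces come from the Hahn-Banach theorem. It
  is proved first, and its real functionals are turned into functionals that are linear over the scalar field.
\<close>

section \<open>The Hahn-Banach theorem\<close>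

definition sublinear :: "('a::real_vector \<Rightarrow> real) \<Rightarrow> bool" where
  "sublinear p \<longleftrightarrow>
     (\<forall>x y. p (x + y) \<le> p x + p y) \<and> (\<forall>t x. 0 \<le> t \<longrightarrow> p (t *\<^sub>R x) = t * p x)"

lemma sublinear_add: "sublinear p \<Longrightarrow> p (x + y) \<le> p x + p y"
  and sublinear_scaleR: "sublinear p \<Longrightarrow> 0 \<le> t \<Longrightarrow> p (t *\<^sub>R x) = t * p x"
  and sublinear_zero: "sublinear p \<Longrightarrow> p 0 = 0"
  unfolding sublinear_def by (auto dest: spec[of _ "0::real"])

lemma sublinear_ge: "sublinear p \<Longrightarrow> - p (- x) \<le> p x"
  using sublinear_add[of p x "- x"] sublinear_zero[of p] by simp

text \<open>The reverse inequality comes from the stated one for \<open>1/t\<close>.\<close>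

lemma sublinearI:
  fixes p :: "'a::real_vector \<Rightarrow> real"
  assumes add: "\<And>x y. p (x + y) \<le> p x + p y"
    and zero: "p 0 = 0"
    and scale: "\<And>t x. 0 < t \<Longrightarrow> p (t *\<^sub>R x) \<le> t * p x"
  shows "sublinear p"
  unfolding sublinear_def
proof (intro conjI allI impI add)
  fix t :: real and x :: 'a
  assume "0 \<le> t"
  show "p (t *\<^sub>R x) = t * p x"
  proof (cases "t = 0")
    case True
    then show ?thesis by (simp add: zero)
  next
    case False
    with \<open>0 \<le> t\<close> have t: "0 < t" by simp
    have "p x \<le> inverse t * p (t *\<^sub>R x)"
      using scale[of "inverse t" "t *\<^sub>R x"] t by simp
    then have "t * p x \<le> p (t *\<^sub>R x)"
      using t by (simp add: field_simps)
    with scale[OF t, of x] show ?thesis by simp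
  qed
qed

text \<open>
  Sublinearity makes \<open>t \<mapsto> p (x + t y) - t p y\<close> decreasing, so \<open>tilt p y x\<close> is its limit as
  \<open>t \<longlonglongrightarrow> \<infinity>\<close>: the directional derivative of \<open>p\<close> at the point \<open>y\<close> in direction \<open>x\<close>. Passing from \<open>p\<close> to
  \<open>tilt p y\<close> keeps sublinearity, stays below \<open>p\<close>, and produces a function
  that is linear on the line through \<open>y\<close>.
\<close>

definition tilt :: "('a::real_vector \<Rightarrow> real) \<Rightarrow> 'a \<Rightarrow> 'a \<Rightarrow> real" where
  "tilt p y x = (INF t\<in>{0..}. p (x + t *\<^sub>R y) - t * p y)"

context
  fixes p :: "'a::real_vector \<Rightarrow> real" and y :: 'a
  assumes p: "sublinear p"
begin

lemma tilt_lower: "0 \<le> t \<Longrightarrow> - p (- x) \<le> p (x + t *\<^sub>R y) - t * p y"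
  using sublinear_add[OF p, of "x + t *\<^sub>R y" "- x"] sublinear_scaleR[OF p, of t y] by simp

lemma tilt_le: "0 \<le> t \<Longrightarrow> tilt p y x \<le> p (x + t *\<^sub>R y) - t * p y"
  unfolding tilt_def by (rule cINF_lower) (auto intro!: bdd_belowI2 tilt_lower)

lemma tilt_greatest:
  "(\<And>t. 0 \<le> t \<Longrightarrow> m \<le> p (x + t *\<^sub>R y) - t * p y) \<Longrightarrow> m \<le> tilt p y x"
  unfolding tilt_def by (rule cINF_greatest) auto

lemma tilt_le_self: "tilt p y x \<le> p x"
  using tilt_le[of 0 x] by simp

lemma tilt_uminus: "tilt p y (- y) \<le> - p y"
  using tilt_le[of 1 "- y"] sublinear_zero[OF p] by simp

lemma sublinear_tilt: "sublinear (tilt p y)"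
proof (rule sublinearI)
  show "tilt p y (x + x') \<le> tilt p y x + tilt p y x'" for x x'
  proof -
    have "tilt p y (x + x') - (p (x' + t *\<^sub>R y) - t * p y) \<le> tilt p y x" if t: "0 \<le> t" for t
    proof (rule tilt_greatest)
      fix s :: real
      assume s: "0 \<le> s"
      have "tilt p y (x + x') \<le> p (x + x' + (s + t) *\<^sub>R y) - (s + t) * p y"
        using s t by (intro tilt_le) simp
      also have "p (x + x' + (s + t) *\<^sub>R y) \<le> p (x + s *\<^sub>R y) + p (x' + t *\<^sub>R y)"
        using sublinear_add[OF p, of "x + s *\<^sub>R y" "x' + t *\<^sub>R y"] by (simp add: algebra_simps)
      finally show "tilt p y (x + x') - (p (x' + t *\<^sub>R y) - t * p y) \<le> p (x + s *\<^sub>R y) - s * p y"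
        by (simp add: algebra_simps)
    qed
    then have "tilt p y (x + x') - tilt p y x \<le> tilt p y x'"
      by (intro tilt_greatest) (simp add: algebra_simps)
    then show ?thesis by simp
  qed
  show "tilt p y 0 = 0"
  proof (rule antisym)
    show "tilt p y 0 \<le> 0"
      using tilt_le_self[of 0] sublinear_zero[OF p] by simp
    show "0 \<le> tilt p y 0"
      by (rule tilt_greatest) (simp add: sublinear_scaleR[OF p])
  qed
  show "tilt p y (r *\<^sub>R x) \<le> r * tilt p y x" if r: "0 < r" for r x
  proof -
    have "tilt p y (r *\<^sub>R x) / r \<le> tilt p y x"
    proof (rule tilt_greatest)
      fix t :: real
      assume t: "0 \<le> t"
      have "tilt p y (r *\<^sub>R x) \<le> p (r *\<^sub>R x + (r * t) *\<^sub>R y) - (r * t) * p y"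
        using r t by (intro tilt_le) simp
      also have "p (r *\<^sub>R x + (r * t) *\<^sub>R y) = r * p (x + t *\<^sub>R y)"
        using sublinear_scaleR[OF p, of r "x + t *\<^sub>R y"] r by (simp add: algebra_simps)
      finally show "tilt p y (r *\<^sub>R x) / r \<le> p (x + t *\<^sub>R y) - t * p y"
        using r by (simp add: field_simps)
    qed
    then show ?thesis using r by (simp add: field_simps)
  qed
qed

end

text \<open>
  Minimality forces \<open>tilt p y = p\<close>, and the term \<open>t = 1\<close> of the infimum then reads
  \<open>p x \<le> p (x + y) - p y\<close>, the missing half of additivity.
\<close>

lemma linear_minimal_sublinear:
  assumes p: "sublinear p"
    and minimal: "\<And>q. sublinear q \<Longrightarrow> (\<forall>x. q x \<le> p x) \<Longrightarrow> q = p"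
  shows "linear p"
proof -
  have "p x + p y \<le> p (x + y)" for x y
  proof -
    have "tilt p y = p"
      by (intro minimal sublinear_tilt allI tilt_le_self p)
    then show ?thesis
      using tilt_le[OF p, of 1 y x] by simp
  qed
  then have add: "p (x + y) = p x + p y" for x y
    using sublinear_add[OF p, of x y] by (intro antisym)
  have neg: "p (- x) = - p x" for x
    using add[of x "- x"] sublinear_zero[OF p] by simp
  show ?thesis
  proof (rule linearI)
    show "p (t *\<^sub>R x) = t *\<^sub>R p x" for t x
    proof (cases "0 \<le> t")
      case True
      then show ?thesis using sublinear_scaleR[OF p] by simp
    next
      case False
      then show ?thesis using sublinear_scaleR[OF p, of "- t" x] neg[of "t *\<^sub>R x"] by simp
    qed
  qed (rule add)
qed

text \<open>
  The infimum is finite since \<open>q x \<ge> - q (- x)\<close> for each member \<open>q\<close> of the chain, and members below a fixed \<open>q0\<close>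
  satisfy \<open>- q (- x) \<ge> - q0 (- x)\<close>. Subadditivity of the infimum needs a chain: for two members, the
  smaller one bounds both.
\<close>

lemma sublinear_chain_Inf:
  fixes C :: "('a::real_vector \<Rightarrow> real) set"
  assumes "C \<noteq> {}"
    and sub: "\<And>q. q \<in> C \<Longrightarrow> sublinear q"
    and chain: "\<And>q q'. q \<in> C \<Longrightarrow> q' \<in> C \<Longrightarrow> (\<forall>x. q x \<le> q' x) \<or> (\<forall>x. q' x \<le> q x)"
  shows "sublinear (\<lambda>x. INF q\<in>C. q x)" and "\<And>q x. q \<in> C \<Longrightarrow> (INF q\<in>C. q x) \<le> q x"
proof -
  obtain q0 where q0: "q0 \<in> C" using \<open>C \<noteq> {}\<close> by blast
  have bdd: "bdd_below ((\<lambda>q. q x) ` C)" for x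
  proof (rule bdd_belowI2[where m = "min (q0 x) (- q0 (- x))"])
    fix q assume q: "q \<in> C"
    show "min (q0 x) (- q0 (- x)) \<le> q x"
      using chain[OF q q0] sublinear_ge[OF sub[OF q], of x]
      by (smt (verit))
  qed
  show lower: "(INF q\<in>C. q x) \<le> q x" if "q \<in> C" for q x
    using that by (intro cINF_lower bdd)
  show "sublinear (\<lambda>x. INF q\<in>C. q x)"
  proof (rule sublinearI)
    fix x y
    have "(INF q\<in>C. q (x + y)) \<le> q x + q' y" if q: "q \<in> C" "q' \<in> C" for q q'
      using chain[OF q] lower[OF q(1), of "x + y"] lower[OF q(2), of "x + y"]
        sublinear_add[OF sub[OF q(1)], of x y] sublinear_add[OF sub[OF q(2)], of x y]
      by (smt (verit))
    then have "(INF q\<in>C. q (x + y)) - q' y \<le> (INF q\<in>C. q x)" if "q' \<in> C" for q'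
      using that \<open>C \<noteq> {}\<close> by (intro cINF_greatest) (auto simp: algebra_simps)
    then have "(INF q\<in>C. q (x + y)) - (INF q\<in>C. q x) \<le> (INF q\<in>C. q y)"
      using \<open>C \<noteq> {}\<close> by (intro cINF_greatest) (auto simp: algebra_simps)
    then show "(INF q\<in>C. q (x + y)) \<le> (INF q\<in>C. q x) + (INF q\<in>C. q y)"
      by simp
  next
    show "(INF q\<in>C. q 0) = 0"
      using \<open>C \<noteq> {}\<close> by (simp add: sublinear_zero sub cong: INF_cong)
  next
    fix t :: real and x
    assume t: "0 < t"
    have "(INF q\<in>C. q (t *\<^sub>R x)) / t \<le> (INF q\<in>C. q x)"
    proof (rule cINF_greatest[OF \<open>C \<noteq> {}\<close>])
      fix q assume q: "q \<in> C"
      show "(INF q\<in>C. q (t *\<^sub>R x)) / t \<le> q x"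
        using lower[OF q, of "t *\<^sub>R x"] sublinear_scaleR[OF sub[OF q], of t x] t
        by (simp add: field_simps)
    qed
    then show "(INF q\<in>C. q (t *\<^sub>R x)) \<le> t * (INF q\<in>C. q x)"
      using t by (simp add: field_simps)
  qed
qed

text \<open>
  Zorn's lemma is applied to sublinear functions ordered by reversed pointwise comparison, rather than to
  partially defined linear functionals. A minimal sublinear function is already linear and everywhere defined.
\<close>

theorem Hahn_Banach_sublinear:
  fixes p :: "'a::real_vector \<Rightarrow> real"
  assumes p: "sublinear p"
  shows "\<exists>f. linear f \<and> (\<forall>x. f x \<le> p x)"
proof -
  define A where "A = {q. sublinear q \<and> q \<le> p}"
  have "\<exists>m\<in>A. \<forall>q\<in>A. m \<ge> q \<longrightarrow> q = m"
  proof (rule predicate_Zorn)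
    show "partial_order_on A (relation_of (\<ge>) A)"
      by (rule partial_order_on_relation_ofI) auto
    fix C assume C: "C \<in> Chains (relation_of (\<ge>) A)"
    show "\<exists>u\<in>A. \<forall>q\<in>C. q \<ge> u"
    proof (cases "C = {}")
      case True
      then show ?thesis using p by (auto simp: A_def)
    next
      case False
      have CA: "C \<subseteq> A" using C by (auto simp: Chains_def relation_of_def)
      have chain: "(\<forall>x. q x \<le> q' x) \<or> (\<forall>x. q' x \<le> q x)" if "q \<in> C" "q' \<in> C" for q q'
        using C that by (auto simp: Chains_def relation_of_def le_fun_def)

      have sub: "sublinear q" if "q \<in> C" for q using CA that by (auto simp: A_def)
      define u where "u x = (INF q\<in>C. q x)" for x
      have u: "sublinear u" and lower: "u x \<le> q x" if "q \<in> C" for q x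
        using sublinear_chain_Inf[OF False sub chain] that unfolding u_def by blast+
      obtain q0 where q0: "q0 \<in> C" using False by blast
      have "u \<in> A"
        using u[OF q0] lower[OF q0] q0 CA by (auto simp: A_def le_fun_def intro: order_trans)
      with lower show ?thesis by (auto simp: le_fun_def)
    qed
  qed
  then obtain f where f: "f \<in> A" and min: "\<And>q. q \<in> A \<Longrightarrow> q \<le> f \<Longrightarrow> q = f" by blast
  have "linear f"
  proof (rule linear_minimal_sublinear)
    show "sublinear f" using f by (simp add: A_def)
    show "q = f" if "sublinear q" "\<forall>x. q x \<le> f x" for q
      using that f by (intro min) (auto simp: A_def le_fun_def intro: order_trans)
  qed
  with f show ?thesis by (auto simp: A_def le_fun_def)
qed

text \<open>
  Dominating by \<open>tilt norm v\<close> instead of the norm gives in addition \<open>f (- v) \<le> - norm v\<close>, hence \<open>f v \<noteq> 0\<close>.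
\<close>

lemma exists_bounded_linear_functional:
  fixes v :: "'a::real_normed_vector"
  assumes "v \<noteq> 0"
  shows "\<exists>f::'a \<Rightarrow> real. bounded_linear f \<and> f v \<noteq> 0"
proof -
  have norm: "sublinear (norm :: 'a \<Rightarrow> real)"
    by (auto simp: sublinear_def norm_triangle_ineq)
  obtain f where f: "linear f" and le: "\<And>x. f x \<le> tilt norm v x"
    using Hahn_Banach_sublinear[OF sublinear_tilt[OF norm]] by blast
  have upper: "f x \<le> norm x" for x
    using le[of x] tilt_le_self[OF norm, of v x] by linarith
  have "\<bar>f x\<bar> \<le> norm x" for x
    using upper[of x] upper[of "- x"] linear_neg[OF f, of x] by simp
  then have "bounded_linear f"
    using f by (intro bounded_linear_intro[where K = 1])
      (auto simp: linear_add linear_scale)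
  moreover have "f v \<noteq> 0"
    using le[of "- v"] tilt_uminus[OF norm, of v] linear_neg[OF f, of v] assms
    by (smt (verit) zero_less_norm_iff)
  ultimately show ?thesis by blast
qed

section \<open>Functionals that are linear over the scalar field\<close>

context banach_space_over
begin

lemma smul_scaleR_left: "smul (r *\<^sub>R c) x = r *\<^sub>R smul c x"
  by (metis scale_scale smul_of_real scaleR_conv_of_real)

lemma smul_scaleR_right: "smul c (r *\<^sub>R x) = r *\<^sub>R smul c x"
  by (metis scale_left_commute smul_of_real)

lemma bounded_linear_smul_right: "bounded_linear (smul c)"
  by (rule bounded_linear_intro[where K = "norm c"])
    (simp_all add: scale_right_distrib smul_scaleR_right norm_smul mult.commute)

lemma bounded_linear_smul_left: "bounded_linear (\<lambda>c. smul c x)"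
  by (rule bounded_linear_intro[where K = "norm x"])
    (simp_all add: scale_left_distrib smul_scaleR_left norm_smul)

text \<open>
  A real functional determines a \<open>'k\<close>-linear one. The real bilinear form \<open>(c, d) \<mapsto> inner (c * d) 1\<close>
  on \<open>'k\<close> is nondegenerate because \<open>inner (c * inverse c) 1 \<noteq> 0\<close>. Hence \<open>c \<mapsto> f (smul c x)\<close> is
  represented by a unique \<open>\<phi> x\<close>; over \<open>\<complex>\<close> this is the usual passage from the real part of a functional
  to the functional.
\<close>

lemma exists_dual_functional:
  assumes "u \<noteq> 0"
  shows "\<exists>\<phi>\<in>dual_space smul. blinfun_apply \<phi> u = 1"
proof -
  obtain f :: "'a \<Rightarrow> real" where f: "bounded_linear f" and fu: "f u \<noteq> 0"
    using exists_bounded_linear_functional[OF assms] by blast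
  interpret f: bounded_linear f by (rule f)
  \<comment> \<open>\<open>L\<close> is the matrix of the bilinear form: \<open>inner (c * d) 1 = inner c (L d)\<close>. Nondegeneracy makes it
    invertible, so the functional with values \<open>f (smul b x)\<close> on the basis is represented by \<open>M (g x)\<close>.\<close>
  define L :: "'k \<Rightarrow> 'k" where "L d = (\<Sum>b\<in>Basis. inner (b * d) 1 *\<^sub>R b)" for d
  have L: "linear L"
    by (rule linearI) (auto simp: L_def algebra_simps inner_add_left sum.distrib scaleR_sum_right)
  have pair: "inner (c * d) 1 = inner c (L d)" for c d
  proof -
    have "c * d = (\<Sum>b\<in>Basis. inner c b *\<^sub>R (b * d))"
      by (subst euclidean_representation[of c, symmetric]) (simp add: sum_distrib_right del: euclidean_representation)
    then show ?thesis
      by (simp add: L_def inner_sum_left inner_sum_right mult.commute)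
  qed
  have "inj L"
  proof (rule linear_injective_0[OF L, THEN iffD2], intro allI impI)
    fix d assume "L d = 0"
    with pair[of "inverse d" d] show "d = 0" by (cases "d = 0") auto
  qed
  then obtain M where M: "linear M" and LM: "\<And>c. L (M c) = c"
    using linear_injective_isomorphism[OF L] by blast
  define g where "g x = (\<Sum>b\<in>Basis. f (smul b x) *\<^sub>R b)" for x
  have g: "bounded_linear g"
    unfolding g_def
    by (intro bounded_linear_sum bounded_linear_scaleR_const[THEN bounded_linear_compose]
        bounded_linear_compose[OF bounded_linear_scaleR_left] bounded_linear_compose[OF f bounded_linear_smul_right])
  have rep: "inner (c * M (g x)) 1 = f (smul c x)" for c x
  proof -
    have "smul (\<Sum>b\<in>Basis. inner c b *\<^sub>R b) x = (\<Sum>b\<in>Basis. inner c b *\<^sub>R smul b x)"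
      by (simp add: scale_sum_left smul_scaleR_left del: euclidean_representation)
    then have "f (smul c x) = (\<Sum>b\<in>Basis. inner c b * f (smul b x))"
      by (simp add: f.sum f.scaleR euclidean_representation)
    then show ?thesis
      by (simp add: pair LM g_def inner_sum_right mult.commute)
  qed
  define \<phi> where "\<phi> x = M (g x)" for x
  have bl: "bounded_linear \<phi>"
    unfolding \<phi>_def by (intro bounded_linear_compose[OF _ g] M[unfolded linear_conv_bounded_linear])
  have nondeg: "d = d'" if "\<And>c. inner (c * d) 1 = inner (c * d') 1" for d d' :: 'k
  proof -
    have "L d = L d'"
      using that by (intro vector_eq_ldot[THEN iffD1]) (simp add: pair)
    with \<open>inj L\<close> show ?thesis by (rule injD)
  qed
  have lin: "\<phi> (smul c x) = c * \<phi> x" for c x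
    by (rule nondeg) (simp add: \<phi>_def rep flip: mult.assoc)
  have "\<phi> u \<noteq> 0"
    using rep[of 1 u] fu by (auto simp: \<phi>_def)
  have "bounded_linear (\<lambda>x. inverse (\<phi> u) * \<phi> x)"
    by (intro bounded_linear_mult_right[THEN bounded_linear_compose] bl)
  then have "blinfun_apply (Blinfun (\<lambda>x. inverse (\<phi> u) * \<phi> x)) = (\<lambda>x. inverse (\<phi> u) * \<phi> x)"
    by (rule bounded_linear_Blinfun_apply)
  with \<open>\<phi> u \<noteq> 0\<close> lin show ?thesis
    by (intro bexI[of _ "Blinfun (\<lambda>x. inverse (\<phi> u) * \<phi> x)"]) (auto simp: dual_space_def)
qed

end

section \<open>Compact operators\<close>

lemma compact_operatorI:
  assumes "\<And>B. bounded B \<Longrightarrow> \<exists>M. compact M \<and> blinfun_apply C ` B \<subseteq> M"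
  shows "compact_operator C"
  unfolding compact_operator_def
proof (intro allI impI)
  fix B :: "'a set"
  assume "bounded B"
  with assms obtain M where M: "compact M" "blinfun_apply C ` B \<subseteq> M" by blast
  then have "closure (blinfun_apply C ` B) \<subseteq> M"
    by (intro closure_minimal compact_imp_closed)
  with M(1) show "compact (closure (blinfun_apply C ` B))"
    by (metis compact_Int_closed closed_closure Int_absorb1)
qed

lemma compact_operator_zero: "compact_operator 0"
  by (rule compact_operatorI) (auto intro!: exI[of _ "{0}"])

lemma compact_operator_add:
  assumes "compact_operator C" "compact_operator D"
  shows "compact_operator (C + D)"
proof (rule compact_operatorI)
  fix B :: "'a set"
  assume "bounded B"
  let ?M = "{x + y |x y. x \<in> closure (blinfun_apply C ` B) \<and> y \<in> closure (blinfun_apply D ` B)}"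
  have "compact ?M"
    using assms \<open>bounded B\<close> by (intro compact_sums) (auto simp: compact_operator_def)
  moreover have "blinfun_apply (C + D) ` B \<subseteq> ?M"
    using closure_subset[of "blinfun_apply C ` B"] closure_subset[of "blinfun_apply D ` B"]
    by (force simp: blinfun.bilinear_simps)
  ultimately show "\<exists>M. compact M \<and> blinfun_apply (C + D) ` B \<subseteq> M" by blast
qed

lemma compact_operator_compose_left:
  assumes "compact_operator C"
  shows "compact_operator (S o\<^sub>L C)"
proof (rule compact_operatorI)
  fix B :: "'a set"
  assume "bounded B"
  let ?M = "blinfun_apply S ` closure (blinfun_apply C ` B)"
  have "compact ?M"
    using assms \<open>bounded B\<close>
    by (intro compact_continuous_image continuous_intros) (auto simp: compact_operator_def)
  moreover have "blinfun_apply (S o\<^sub>L C) ` B \<subseteq> ?M"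
    using closure_subset[of "blinfun_apply C ` B"] by auto
  ultimately show "\<exists>M. compact M \<and> blinfun_apply (S o\<^sub>L C) ` B \<subseteq> M" by blast
qed

lemma compact_operator_compose_right:
  assumes "compact_operator C"
  shows "compact_operator (C o\<^sub>L S)"
proof (rule compact_operatorI)
  fix B :: "'c set"
  assume "bounded B"
  then have "bounded (blinfun_apply S ` B)"
    by (rule bounded_linear_image) (rule blinfun.bounded_linear_right)
  then have "compact (closure (blinfun_apply C ` blinfun_apply S ` B))"
    using assms by (simp add: compact_operator_def)
  moreover have "blinfun_apply (C o\<^sub>L S) ` B \<subseteq> closure (blinfun_apply C ` blinfun_apply S ` B)"
    using closure_subset[of "blinfun_apply C ` blinfun_apply S ` B"] by auto
  ultimately show "\<exists>M. compact M \<and> blinfun_apply (C o\<^sub>L S) ` B \<subseteq> M" by blast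
qed

lemma compact_operator_convergent_subsequence:
  fixes u :: "nat \<Rightarrow> 'a::real_normed_vector"
  assumes "compact_operator C" and "\<And>n. norm (u n) \<le> r"
  obtains l \<sigma> where "strict_mono \<sigma>" and "(\<lambda>n. blinfun_apply C (u (\<sigma> n))) \<longlonglongrightarrow> l"
proof -
  have "bounded (range u)"
    using assms(2) by (auto simp: bounded_iff)
  then have "compact (closure (blinfun_apply C ` range u))"
    using assms(1) by (simp add: compact_operator_def)
  then have "seq_compact (closure (blinfun_apply C ` range u))"
    by (rule compact_imp_seq_compact)
  moreover have "\<forall>n. blinfun_apply C (u n) \<in> closure (blinfun_apply C ` range u)"
    using closure_subset[of "blinfun_apply C ` range u"] by auto
  ultimately obtain l \<sigma> where "strict_mono \<sigma>" and lim: "((\<lambda>n. blinfun_apply C (u n)) \<circ> \<sigma>) \<longlonglongrightarrow> l"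
    by (rule seq_compactE)
  from this(1) lim[unfolded o_def] show thesis by (rule that)
qed

lemma compact_operator_not_separated:
  fixes u :: "nat \<Rightarrow> 'a::real_normed_vector"
  assumes C: "compact_operator C" "\<And>n. norm (u n) \<le> r"
    and "0 < \<epsilon>"
    and sep: "\<And>m n. m < n \<Longrightarrow> \<epsilon> \<le> norm (blinfun_apply C (u m) - blinfun_apply C (u n))"
  shows False
proof -
  obtain l \<sigma> where \<sigma>: "strict_mono \<sigma>" and "(\<lambda>n. blinfun_apply C (u (\<sigma> n))) \<longlonglongrightarrow> l"
    by (rule compact_operator_convergent_subsequence[OF C])
  then have "Cauchy (\<lambda>n. blinfun_apply C (u (\<sigma> n)))"
    by (intro LIMSEQ_imp_Cauchy)
  then obtain N where "\<And>m n. m \<ge> N \<Longrightarrow> n \<ge> N \<Longrightarrow>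
      norm (blinfun_apply C (u (\<sigma> m)) - blinfun_apply C (u (\<sigma> n))) < \<epsilon>"
    unfolding Cauchy_iff using \<open>0 < \<epsilon>\<close> by (elim allE[of _ \<epsilon>]) blast
  then have "norm (blinfun_apply C (u (\<sigma> N)) - blinfun_apply C (u (\<sigma> (Suc N)))) < \<epsilon>"
    by simp
  moreover have "\<epsilon> \<le> norm (blinfun_apply C (u (\<sigma> N)) - blinfun_apply C (u (\<sigma> (Suc N))))"
    using \<sigma> by (intro sep) (simp add: strict_mono_def)
  ultimately show False by simp
qed

text \<open>
  Riesz's lemma: take \<open>x\<close> outside \<open>V\<close> and a point \<open>w\<close> of \<open>V\<close> that approximates \<open>x\<close> up to twice the distance of
  \<open>x\<close> from \<open>V\<close>; the normalized difference \<open>x - w\<close> is the required unit vector.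
\<close>

lemma Riesz_almost_orthogonal:
  fixes U V :: "'a::real_normed_vector set"
  assumes "subspace U" "subspace V" "closed V" "V \<subseteq> U" "V \<noteq> U"
  obtains u where "u \<in> U" "norm u = 1" "\<And>v. v \<in> V \<Longrightarrow> 1/2 \<le> norm (u - v)"
proof -
  obtain x where x: "x \<in> U" "x \<notin> V" using assms by blast
  have V: "V \<noteq> {}" using subspace_0[OF \<open>subspace V\<close>] by blast
  define d where "d = infdist x V"
  have d: "0 < d"
    unfolding d_def using x V \<open>closed V\<close> by (intro infdist_pos_not_in_closed)
  have "\<exists>v\<in>V. dist x v < 2 * d"
  proof (rule ccontr)
    assume "\<not> ?thesis"
    then have "2 * d \<le> infdist x V"
      using V by (auto simp: infdist_notempty not_less intro!: cINF_greatest)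
    with d show False by (simp add: d_def)
  qed
  then obtain w where w: "w \<in> V" "norm (x - w) < 2 * d" by (auto simp: dist_norm)
  let ?r = "norm (x - w)"
  have r: "0 < ?r" using x w by auto
  show thesis
  proof (rule that[of "(1 / ?r) *\<^sub>R (x - w)"])
    show "(1 / ?r) *\<^sub>R (x - w) \<in> U"
      using assms x w by (intro subspace_scale subspace_diff) auto
    show "norm ((1 / ?r) *\<^sub>R (x - w)) = 1"
      using r by simp
    fix v assume "v \<in> V"
    then have "w + ?r *\<^sub>R v \<in> V"
      using assms w by (intro subspace_add subspace_scale)
    then have "d \<le> norm (x - (w + ?r *\<^sub>R v))"
      unfolding d_def dist_norm[symmetric] by (rule infdist_le)
    also have "x - (w + ?r *\<^sub>R v) = ?r *\<^sub>R ((1 / ?r) *\<^sub>R (x - w) - v)"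
      using r by (simp add: scaleR_diff_right)
    finally have "d \<le> ?r * norm ((1 / ?r) *\<^sub>R (x - w) - v)" by simp
    with w(2) have "?r * (1/2) < ?r * norm ((1 / ?r) *\<^sub>R (x - w) - v)" by linarith
    with r show "1/2 \<le> norm ((1 / ?r) *\<^sub>R (x - w) - v)" by (simp only: mult_less_cancel_left_pos)
  qed
qed

section \<open>Compact perturbations of the identity\<close>

text \<open>
  The common core of the chain arguments in the Riesz theory. Almost orthogonal unit vectors \<open>u n\<close> of \<open>V n\<close> relative to
  \<open>W n\<close> would have images under \<open>C\<close> at mutual distance at least \<open>1/2\<close>. With \<open>F = I + C\<close> the vector
  \<open>x + (C x - C y)\<close> is \<open>F x - F y + y\<close>. The first alternative of the hypothesis serves the decreasing
  chain of ranges of the powers of \<open>F\<close>, the second the increasing chain of their kernels.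
\<close>

lemma compact_operator_no_chain:
  fixes V W :: "nat \<Rightarrow> 'a::real_normed_vector set"
  assumes C: "compact_operator C"
    and sub: "\<And>n. subspace (V n)" "\<And>n. subspace (W n)" "\<And>n. closed (W n)" "\<And>n. W n \<subset> V n"
    and chain: "\<And>m n x y. m < n \<Longrightarrow> x \<in> V m \<Longrightarrow> y \<in> V n \<Longrightarrow>
      x + (blinfun_apply C x - blinfun_apply C y) \<in> W m \<or>
      y + (blinfun_apply C y - blinfun_apply C x) \<in> W n"
  shows False
proof -
  have "\<exists>u\<in>V n. norm u = 1 \<and> (\<forall>w\<in>W n. 1/2 \<le> norm (u - w))" for n
  proof -
    have "W n \<subseteq> V n" "W n \<noteq> V n" using sub(4)[of n] by auto
    then obtain u where "u \<in> V n" "norm u = 1" "\<And>w. w \<in> W n \<Longrightarrow> 1/2 \<le> norm (u - w)"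
      using Riesz_almost_orthogonal[OF sub(1,2,3)] by metis
    then show ?thesis by blast
  qed
  then obtain u where u: "\<And>n. u n \<in> V n" "\<And>n. norm (u n) = 1"
      "\<And>n w. w \<in> W n \<Longrightarrow> 1/2 \<le> norm (u n - w)"
    by metis
  show False
  proof (rule compact_operator_not_separated[OF C])
    show "norm (u n) \<le> 1" for n by (simp add: u)
    show "0 < (1/2::real)" by simp
    show "1/2 \<le> norm (blinfun_apply C (u m) - blinfun_apply C (u n))" if "m < n" for m n
      using chain[OF that u(1) u(1)] u(3)[of "u m + (blinfun_apply C (u m) - blinfun_apply C (u n))" m]
        u(3)[of "u n + (blinfun_apply C (u n) - blinfun_apply C (u m))" n]
      by (auto simp: norm_minus_commute)
  qed
qed

lemma bounded_linear_funpow: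
  fixes F :: "'a::real_normed_vector \<Rightarrow> 'a"
  assumes "bounded_linear F"
  shows "bounded_linear (F ^^ n)"
proof (induction n)
  case 0
  then show ?case by (simp add: id_def)
next
  case (Suc n)
  then show ?case using bounded_linear_compose[OF assms] by (simp add: o_def)
qed

lemma funpow_kernel_mono:
  fixes F :: "'a::real_normed_vector \<Rightarrow> 'a"
  assumes F: "bounded_linear F" and "m \<le> n" and "(F ^^ m) x = 0"
  shows "(F ^^ n) x = 0"
proof -
  have "(F ^^ (n - m)) ((F ^^ m) x) = (F ^^ n) x"
    using \<open>m \<le> n\<close> by (simp flip: funpow_add[THEN fun_cong, unfolded o_apply])
  then show ?thesis
    using assms(3) bounded_linear_funpow[OF F, of "n - m"]
    by (simp add: bounded_linear.linear linear_0)
qed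

lemma id_plus_compact_kernels_stabilize:
  fixes C :: "'a::real_normed_vector \<Rightarrow>\<^sub>L 'a"
  assumes "compact_operator C"
  shows "\<exists>n. \<forall>x. (blinfun_apply (id_blinfun + C) ^^ Suc n) x = 0 \<longrightarrow>
    (blinfun_apply (id_blinfun + C) ^^ n) x = 0"
proof (rule ccontr)
  let ?F = "blinfun_apply (id_blinfun + C)"
  define N where "N n = {x. (?F ^^ n) x = 0}" for n
  have blF: "bounded_linear ?F" by (rule blinfun.bounded_linear_right)
  note bl = bounded_linear_funpow[OF blF]
  note lin = bl[THEN bounded_linear.linear]
  have mono: "N m \<subseteq> N n" if "m \<le> n" for m n
    using funpow_kernel_mono[OF blF that] by (auto simp: N_def)
  have sub: "subspace (N n)" for n
    unfolding N_def by (rule linear_subspace_kernel[OF lin])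
  have F: "?F y \<in> N n" if "y \<in> N (Suc n)" for y n
    using that by (simp add: N_def funpow_swap1)
  assume "\<nexists>n. \<forall>x. (?F ^^ Suc n) x = 0 \<longrightarrow> (?F ^^ n) x = 0"
  then have strict: "N n \<subset> N (Suc n)" for n
    using mono[of n "Suc n"] by (auto simp: N_def)
  show False
  proof (rule compact_operator_no_chain[OF assms, of "\<lambda>n. N (Suc n)" N])
    show "closed (N n)" for n
      unfolding N_def
      by (intro closed_Collect_eq continuous_intros linear_continuous_on[OF bl])
    fix m n x y assume mn: "m < n" and x: "x \<in> N (Suc m)" and y: "y \<in> N (Suc n)"
    have "x \<in> N n" "?F x \<in> N n" "?F y \<in> N n"
      using mono[of "Suc m" n] mono[of m n] F[OF x] F[OF y] mn x by auto
    then have "?F y - ?F x + x \<in> N n"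
      using sub by (intro subspace_add subspace_diff)
    also have "?F y - ?F x + x = y + (blinfun_apply C y - blinfun_apply C x)"
      by (simp add: blinfun.bilinear_simps)
    finally show "x + (blinfun_apply C x - blinfun_apply C y) \<in> N m \<or>
        y + (blinfun_apply C y - blinfun_apply C x) \<in> N n" ..
  qed (use sub strict in auto)
qed

text \<open>
  Otherwise unit vectors \<open>x n\<close> satisfy \<open>F (x n) \<longlonglongrightarrow> 0\<close> for \<open>F = I + C\<close>. Along a subsequence \<open>C (x n)\<close> converges to
  some \<open>l\<close>, so \<open>x n = F (x n) - C (x n)\<close> converges to \<open>- l\<close>, a unit vector in the kernel of \<open>F\<close>.
\<close>

lemma id_plus_compact_bounded_below:
  fixes C :: "'a::real_normed_vector \<Rightarrow>\<^sub>L 'a"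
  assumes C: "compact_operator C"
    and inj: "\<And>x. blinfun_apply (id_blinfun + C) x = 0 \<Longrightarrow> x = 0"
  shows "\<exists>c>0. \<forall>x. norm x \<le> c * norm (blinfun_apply (id_blinfun + C) x)"
proof (rule ccontr)
  let ?F = "blinfun_apply (id_blinfun + C)"
  assume neg: "\<not> ?thesis"
  have "\<exists>x. norm x = 1 \<and> norm (?F x) < 1 / real (Suc n)" for n
  proof -
    have "0 < real (Suc n)" by simp
    with neg have "\<not> (\<forall>x. norm x \<le> real (Suc n) * norm (?F x))" by blast
    then obtain x where x: "real (Suc n) * norm (?F x) < norm x"
      by (auto simp only: not_all not_le)
    then have "0 < norm x"
      by (rule le_less_trans[rotated]) simp
    with x show ?thesis
      by (intro exI[of _ "(1 / norm x) *\<^sub>R x"])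
        (simp add: blinfun.scaleR_right field_simps del: of_nat_Suc)
  qed
  then obtain x where x: "\<And>n. norm (x n) = 1" "\<And>n. norm (?F (x n)) < 1 / real (Suc n)"
    by metis
  obtain l \<sigma> where \<sigma>: "strict_mono \<sigma>" and l: "(\<lambda>n. blinfun_apply C (x (\<sigma> n))) \<longlonglongrightarrow> l"
    by (rule compact_operator_convergent_subsequence[OF C, of x 1]) (simp_all add: x(1))
  have "(\<lambda>n. ?F (x n)) \<longlonglongrightarrow> 0"
  proof (rule Lim_null_comparison[OF _ LIMSEQ_inverse_real_of_nat])
    show "\<forall>\<^sub>F n in sequentially. norm (?F (x n)) \<le> inverse (real (Suc n))"
      using x(2) by (auto simp: inverse_eq_divide less_imp_le)
  qed
  then have F0: "(\<lambda>n. ?F (x (\<sigma> n))) \<longlonglongrightarrow> 0"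
    using \<sigma> LIMSEQ_subseq_LIMSEQ by (fastforce simp: o_def)
  have "(\<lambda>n. ?F (x (\<sigma> n)) - blinfun_apply C (x (\<sigma> n))) \<longlonglongrightarrow> 0 - l"
    by (intro tendsto_diff F0 l)
  then have lim: "(\<lambda>n. x (\<sigma> n)) \<longlonglongrightarrow> - l"
    by (simp add: blinfun.bilinear_simps)
  then have "(\<lambda>n. ?F (x (\<sigma> n))) \<longlonglongrightarrow> ?F (- l)"
    by (intro tendsto_intros)
  then have "?F (- l) = 0"
    using F0 LIMSEQ_unique by blast
  then have "l = 0" using inj by fastforce
  moreover have "norm (- l) = 1"
    using tendsto_norm[OF lim] x(1) by (simp add: LIMSEQ_const_iff)
  ultimately show False by simp
qed

lemma bounded_below_closed_image:
  fixes F :: "'a::banach \<Rightarrow> 'b::real_normed_vector"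
  assumes F: "bounded_linear F" and c: "0 < c" "\<And>x. norm x \<le> c * norm (F x)"
    and V: "closed V"
  shows "closed (F ` V)"
  unfolding closed_sequential_limits
proof (intro allI impI, elim conjE)
  interpret F: bounded_linear F by (rule F)
  fix y l assume "\<forall>n. y n \<in> F ` V" and y: "y \<longlonglongrightarrow> l"
  then obtain x where x: "\<And>n. x n \<in> V" "\<And>n. y n = F (x n)"
    unfolding image_iff Bex_def by (metis (no_types))
  have "Cauchy x"
    unfolding Cauchy_iff
  proof (intro allI impI)
    fix e :: real assume "0 < e"
    then have "0 < e / c" using c by simp
    then obtain M where M: "\<And>m n. m \<ge> M \<Longrightarrow> n \<ge> M \<Longrightarrow> norm (y m - y n) < e / c"
      using LIMSEQ_imp_Cauchy[OF y] unfolding Cauchy_iff by metis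
    have "norm (x m - x n) < e" if "m \<ge> M" "n \<ge> M" for m n
      using M[OF that] c(2)[of "x m - x n"] c(1) by (simp add: x F.diff field_simps)
    then show "\<exists>M. \<forall>m\<ge>M. \<forall>n\<ge>M. norm (x m - x n) < e" by blast
  qed
  then obtain z where z: "x \<longlonglongrightarrow> z"
    by (auto simp: Cauchy_convergent_iff convergent_def)
  then have "z \<in> V"
    using V x(1) closed_sequentially by blast
  moreover have "y \<longlonglongrightarrow> F z"
    using F.tendsto[OF z] by (simp only: ext[of y, OF x(2)])
  ultimately show "l \<in> F ` V"
    using y LIMSEQ_unique by blast
qed

text \<open>
  If \<open>F = I + C\<close> is injective but not surjective, then the ranges of its powers
  decrease strictly; they are closed because \<open>F\<close> is bounded below, which contradicts \<open>compact_operator_no_chain\<close>.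
\<close>

lemma id_plus_compact_surj:
  fixes C :: "'a::banach \<Rightarrow>\<^sub>L 'a"
  assumes C: "compact_operator C"
    and inj: "\<And>x. blinfun_apply (id_blinfun + C) x = 0 \<Longrightarrow> x = 0"
  shows "surj (blinfun_apply (id_blinfun + C))"
proof (rule ccontr)
  let ?F = "blinfun_apply (id_blinfun + C)"
  define R where "R n = range (?F ^^ n)" for n
  have blF: "bounded_linear ?F" by (rule blinfun.bounded_linear_right)
  note lin = bounded_linear_funpow[OF blF, THEN bounded_linear.linear]
  obtain c where c: "0 < c" "\<And>x. norm x \<le> c * norm (?F x)"
    using id_plus_compact_bounded_below[OF C inj] by blast
  have R_Suc: "R (Suc n) = ?F ` R n" for n
    by (auto simp: R_def image_comp)
  have sub: "subspace (R n)" for n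
    unfolding R_def by (intro linear_subspace_image[OF lin] subspace_UNIV)
  have closed: "closed (R n)" for n
  proof (induction n)
    case 0
    then show ?case by (simp add: R_def)
  next
    case (Suc n)
    then show ?case
      unfolding R_Suc by (rule bounded_below_closed_image[OF blF c])
  qed
  have Suc_sub: "R (Suc n) \<subseteq> R n" for n
    by (auto simp: R_def funpow_Suc_right simp del: funpow.simps)
  then have mono: "R n \<subseteq> R m" if "m \<le> n" for m n
    using lift_Suc_antimono_le[of R m n] that by blast
  have injF: "inj ?F"
    by (rule injI) (metis inj blinfun.diff_right right_minus_eq)
  assume "\<not> surj ?F"
  then have "R 1 \<noteq> R 0" by (simp add: R_def)
  then have "R (Suc n) \<noteq> R n" for n
  proof (induction n)
    case (Suc n)
    then show ?case
      using inj_image_eq_iff[OF injF, of "R (Suc n)" "R n"] by (simp flip: R_Suc)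
  qed simp
  with Suc_sub have strict: "R (Suc n) \<subset> R n" for n by blast
  show False
  proof (rule compact_operator_no_chain[OF C, of R "\<lambda>n. R (Suc n)"])
    fix m n x y assume "m < n" and x: "x \<in> R m" and y: "y \<in> R n"
    have "y \<in> R (Suc m)" "?F x \<in> R (Suc m)" "?F y \<in> R (Suc m)"
      using mono[of "Suc m" n] mono[of m n] x y \<open>m < n\<close> by (auto simp: R_Suc)
    then have "?F x - ?F y + y \<in> R (Suc m)"
      using sub by (intro subspace_add subspace_diff)
    also have "?F x - ?F y + y = x + (blinfun_apply C x - blinfun_apply C y)"
      by (simp add: blinfun.bilinear_simps)
    finally show "x + (blinfun_apply C x - blinfun_apply C y) \<in> R (Suc m) \<or>
        y + (blinfun_apply C y - blinfun_apply C x) \<in> R (Suc n)" ..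
  qed (use sub closed strict in auto)
qed

text \<open>
  Some power \<open>F' = F\<^sup>m\<close> of \<open>F = I + C\<close> has \<open>\<N>(F' F') = \<N>(F')\<close>, which means that
  its kernel meets its range only in \<open>0\<close>. The exponent is taken to be positive so that \<open>F'\<close> has a right factor \<open>F\<close>.
\<close>

lemma id_plus_compact_ascent:
  fixes C :: "'a::real_normed_vector \<Rightarrow>\<^sub>L 'a"
  assumes "compact_operator C"
  shows "\<exists>n. \<forall>x. (blinfun_apply (id_blinfun + C) ^^ Suc n)
      ((blinfun_apply (id_blinfun + C) ^^ Suc n) x) = 0 \<longrightarrow>
    (blinfun_apply (id_blinfun + C) ^^ Suc n) x = 0"
proof -
  let ?F = "blinfun_apply (id_blinfun + C)"
  obtain n where n: "\<And>x. (?F ^^ Suc n) x = 0 \<Longrightarrow> (?F ^^ n) x = 0"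
    using id_plus_compact_kernels_stabilize[OF assms] by blast
  have stable: "(?F ^^ n) x = 0" if "(?F ^^ (n + k)) x = 0" for k x
    using that
  proof (induction k)
    case (Suc k)
    then have "(?F ^^ (Suc n + k)) x = 0"
      by (simp only: add_Suc add_Suc_right)
    then have "(?F ^^ Suc n) ((?F ^^ k) x) = 0"
      by (simp only: funpow_add o_apply)
    then have "(?F ^^ n) ((?F ^^ k) x) = 0" by (rule n)
    then have "(?F ^^ (n + k)) x = 0"
      by (simp only: funpow_add o_apply)
    then show ?case by (rule Suc.IH)
  qed simp
  have "(?F ^^ Suc n) x = 0" if "(?F ^^ Suc n) ((?F ^^ Suc n) x) = 0" for x
  proof -
    have "(?F ^^ (Suc n + Suc n)) x = 0"
      unfolding funpow_add o_apply by (rule that)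
    then have "(?F ^^ (n + Suc (Suc n))) x = 0"
      by (simp only: add_Suc add_Suc_right)
    then have "(?F ^^ n) x = 0" by (rule stable)
    then show ?thesis by (simp add: blinfun.zero_right)
  qed
  then show ?thesis by blast
qed

section \<open>Scalar-linear operators of finite rank\<close>

context banach_space_over
begin

lemma bounded_operators_apply:
  "T \<in> bounded_operators smul \<Longrightarrow> blinfun_apply T (smul c x) = smul c (blinfun_apply T x)"
  by (simp add: bounded_operators_def)

lemma bounded_operators_intros:
  "id_blinfun \<in> bounded_operators smul"
  "0 \<in> bounded_operators smul"
  "S \<in> bounded_operators smul \<Longrightarrow> T \<in> bounded_operators smul \<Longrightarrow> S + T \<in> bounded_operators smul"
  "S \<in> bounded_operators smul \<Longrightarrow> T \<in> bounded_operators smul \<Longrightarrow> S - T \<in> bounded_operators smul"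
  "S \<in> bounded_operators smul \<Longrightarrow> T \<in> bounded_operators smul \<Longrightarrow> S o\<^sub>L T \<in> bounded_operators smul"
  by (auto simp: bounded_operators_def blinfun.bilinear_simps scale_right_distrib scale_right_diff_distrib)

lemma bounded_operators_module_hom:
  assumes "T \<in> bounded_operators smul"
  shows "module_hom smul smul (blinfun_apply T)"
  by unfold_locales (simp_all add: blinfun.add_right bounded_operators_apply[OF assms])

lemma bounded_operators_span_image:
  "T \<in> bounded_operators smul \<Longrightarrow> span (blinfun_apply T ` B) = blinfun_apply T ` span B"
  by (rule module_hom.span_image[OF bounded_operators_module_hom])

lemma subspace_kernel_bounded_operators:
  assumes "T \<in> bounded_operators smul"
  shows "subspace {x. blinfun_apply T x = 0}"
  by (rule subspaceI) (simp_all add: blinfun.bilinear_simps bounded_operators_apply[OF assms])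

lemma subspace_imp_real_subspace: "subspace V \<Longrightarrow> Real_Vector_Spaces.subspace V"
  unfolding subspace_def Real_Vector_Spaces.subspace_def
  by (metis smul_of_real)

lemma rank_one_operator:
  assumes "\<phi> \<in> dual_space smul"
  shows "\<exists>R\<in>bounded_operators smul. compact_operator R \<and>
    (\<forall>x. blinfun_apply R x = smul (blinfun_apply \<phi> x) w)"
proof -
  define R where "R = Blinfun (\<lambda>x. smul (blinfun_apply \<phi> x) w)"
  have "bounded_linear (\<lambda>x. smul (blinfun_apply \<phi> x) w)"
    by (rule bounded_linear_compose[OF bounded_linear_smul_left blinfun.bounded_linear_right])
  then have R: "blinfun_apply R x = smul (blinfun_apply \<phi> x) w" for x
    unfolding R_def by (simp add: bounded_linear_Blinfun_apply)
  have "R \<in> bounded_operators smul"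
    using assms by (simp add: bounded_operators_def dual_space_def R scale_scale)
  moreover have "compact_operator R"
  proof (rule compact_operatorI)
    fix B :: "'a set"
    assume "bounded B"
    then have "bounded (blinfun_apply \<phi> ` B)"
      by (rule bounded_linear_image) (rule blinfun.bounded_linear_right)
    then have "compact ((\<lambda>c. smul c w) ` closure (blinfun_apply \<phi> ` B))"
      by (intro compact_continuous_image linear_continuous_on bounded_linear_smul_left)
        (simp add: compact_closure)
    moreover have "blinfun_apply R ` B \<subseteq> (\<lambda>c. smul c w) ` closure (blinfun_apply \<phi> ` B)"
      using closure_subset[of "blinfun_apply \<phi> ` B"] by (auto simp: R)
    ultimately show "\<exists>M. compact M \<and> blinfun_apply R ` B \<subseteq> M" by blast
  qed
  ultimately show ?thesis using R by blast
qed

text \<open>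
  A bounded right inverse of \<open>E\<close> on a finite-dimensional subspace of its range. For \<open>E = I\<close> it is a compact projection
  onto the subspace; for \<open>E\<close> of finite rank and the subspace equal to its range it is a
  generalized inverse of \<open>E\<close>. When a vector \<open>v\<close> is added, the defect \<open>u = v - E (D v)\<close> measures how far
  the old section \<open>D\<close> is from treating \<open>v\<close> correctly. If \<open>u \<noteq> 0\<close>, a functional \<open>\<phi>\<close>
  with \<open>\<phi> u = 1\<close> yields a rank one correction; it vanishes on the old subspace because it is composed
  with \<open>I - E D\<close>.
\<close>

lemma finite_dimensional_section:
  assumes E: "E \<in> bounded_operators smul" and "finite B" and "B \<subseteq> range (blinfun_apply E)"
  shows "\<exists>D\<in>bounded_operators smul. compact_operator D \<and>
    (\<forall>x. blinfun_apply E (blinfun_apply D x) \<in> span B) \<and>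
    (\<forall>x\<in>span B. blinfun_apply E (blinfun_apply D x) = x)"
  using assms(2,3)
proof (induction B)
  case empty
  show ?case
    by (intro bexI[of _ 0]) (auto simp: compact_operator_zero bounded_operators_intros blinfun.zero_right)
next
  case (insert v B)
  then obtain D where D: "D \<in> bounded_operators smul" and compact: "compact_operator D"
    and into: "\<And>x. blinfun_apply E (blinfun_apply D x) \<in> span B"
    and ED: "\<And>x. x \<in> span B \<Longrightarrow> blinfun_apply E (blinfun_apply D x) = x"
    by auto
  define u where "u = v - blinfun_apply E (blinfun_apply D v)"
  show ?case
  proof (cases "u = 0")
    case True
    then have "v \<in> span B" using into[of v] by (simp add: u_def)
    then have "span (insert v B) = span B" by (rule span_redundant)
    with D compact into ED show ?thesis by auto
  next
    case False
    obtain e where e: "v = blinfun_apply E e" using insert.prems by auto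
    obtain \<phi> where \<phi>: "\<phi> \<in> dual_space smul" "blinfun_apply \<phi> u = 1"
      using exists_dual_functional[OF False] by blast
    obtain R where R: "R \<in> bounded_operators smul" "compact_operator R"
      and R_apply: "\<And>x. blinfun_apply R x = smul (blinfun_apply \<phi> x) (e - blinfun_apply D v)"
      using rank_one_operator[OF \<phi>(1)] by blast
    define D' where "D' = D + (R o\<^sub>L (id_blinfun - (E o\<^sub>L D)))"
    have D': "D' \<in> bounded_operators smul"
      unfolding D'_def by (intro bounded_operators_intros D E R)
    have ED': "blinfun_apply E (blinfun_apply D' x) = blinfun_apply E (blinfun_apply D x) +
        smul (blinfun_apply \<phi> (x - blinfun_apply E (blinfun_apply D x))) u" for x
      by (simp add: D'_def R_apply blinfun.bilinear_simps bounded_operators_apply[OF E] u_def e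
          scale_left_diff_distrib)
    have "span B \<subseteq> span (insert v B)" by (rule span_mono) blast
    then have incl: "x \<in> span (insert v B)" if "x \<in> span B" for x using that by blast
    have u: "u \<in> span (insert v B)"
      unfolding u_def by (intro span_diff span_base incl into) simp
    have "subspace {x. blinfun_apply ((E o\<^sub>L D') - id_blinfun) x = 0}"
      by (intro subspace_kernel_bounded_operators bounded_operators_intros E D')
    moreover have "insert v B \<subseteq> {x. blinfun_apply ((E o\<^sub>L D') - id_blinfun) x = 0}"
    proof (intro insert_subsetI subsetI CollectI)
      show "blinfun_apply ((E o\<^sub>L D') - id_blinfun) v = 0"
        using \<phi>(2) by (simp add: blinfun.diff_left ED' flip: u_def) (simp add: u_def)
      show "blinfun_apply ((E o\<^sub>L D') - id_blinfun) x = 0" if "x \<in> B" for x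
        using ED[OF span_base[OF that]] by (simp add: blinfun.bilinear_simps ED')
    qed
    ultimately have "span (insert v B) \<subseteq> {x. blinfun_apply ((E o\<^sub>L D') - id_blinfun) x = 0}"
      by (intro span_minimal)
    then have "\<forall>x\<in>span (insert v B). blinfun_apply E (blinfun_apply D' x) = x"
      by (auto simp: blinfun.diff_left)
    moreover have "\<forall>x. blinfun_apply E (blinfun_apply D' x) \<in> span (insert v B)"
      unfolding ED' by (intro allI span_add span_scale incl into u)
    moreover have "compact_operator D'"
      unfolding D'_def
      by (intro compact_operator_add compact compact_operator_compose_right R)
    ultimately show ?thesis using D' by blast
  qed
qed

lemma finite_dimensional_projection:
  assumes "finite B"
  shows "\<exists>P\<in>bounded_operators smul. compact_operator P \<and>
    (\<forall>x. blinfun_apply P x \<in> span B) \<and> (\<forall>x\<in>span B. blinfun_apply P x = x)"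
  using finite_dimensional_section[OF bounded_operators_intros(1) assms] by simp

lemma closed_finite_span:
  assumes "finite B"
  shows "closed (span B)"
proof -
  obtain P where P: "\<And>x. blinfun_apply P x \<in> span B" "\<And>x. x \<in> span B \<Longrightarrow> blinfun_apply P x = x"
    using finite_dimensional_projection[OF assms] by blast
  have "span B = {x. blinfun_apply P x = x}"
    using P by (metis (mono_tags) Collect_cong Collect_mem_eq)
  moreover have "closed {x. blinfun_apply P x = x}"
    by (intro closed_Collect_eq continuous_intros)
  ultimately show ?thesis by simp
qed

text \<open>
  On the kernel \<open>C\<close> acts as \<open>- I\<close>, so the unit ball of the kernel is relatively compact. The centres of
  a finite cover by balls of radius \<open>1/2\<close> span the kernel, since a unit vector almost orthogonal to their
  span would lie in none of the balls.
\<close>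

lemma id_plus_compact_kernel_finite_dimensional:
  assumes C: "C \<in> bounded_operators smul" "compact_operator C"
  shows "\<exists>B. finite B \<and> {x. blinfun_apply (id_blinfun + C) x = 0} = span B"
proof -
  define N where "N = {x. blinfun_apply (id_blinfun + C) x = 0}"
  have N: "subspace N"
    unfolding N_def by (intro subspace_kernel_bounded_operators bounded_operators_intros C)
  have "closed N"
    unfolding N_def by (intro closed_Collect_eq continuous_intros)
  have C_N: "blinfun_apply C x = - x" if "x \<in> N" for x
    using that by (simp add: N_def blinfun.add_left eq_neg_iff_add_eq_0 add.commute)
  define M where "M = closure (blinfun_apply C ` (N \<inter> cball 0 1))"
  have "blinfun_apply C ` (N \<inter> cball 0 1) \<subseteq> N"
    using C_N subspace_neg[OF N] by auto
  then have "M \<subseteq> N"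
    unfolding M_def using \<open>closed N\<close> by (rule closure_minimal)
  have "compact M"
    unfolding M_def using C(2) by (auto simp: compact_operator_def intro: bounded_subset[OF bounded_cball])
  then obtain B where B: "finite B" "B \<subseteq> M" "M \<subseteq> (\<Union>x\<in>B. ball x (1/2))"
    using seq_compact_imp_totally_bounded[OF compact_imp_seq_compact, of M] by (meson half_gt_zero zero_less_one)
  have "span B = N"
  proof (rule ccontr)
    assume "span B \<noteq> N"
    moreover have "span B \<subseteq> N"
      using B \<open>M \<subseteq> N\<close> N by (intro span_minimal) auto
    ultimately obtain u where u: "u \<in> N" "norm u = 1" and far: "\<And>v. v \<in> span B \<Longrightarrow> 1/2 \<le> norm (u - v)"
      using Riesz_almost_orthogonal[OF subspace_imp_real_subspace[OF N]
          subspace_imp_real_subspace[OF subspace_span] closed_finite_span[OF B(1)]] by blast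
    have "blinfun_apply C u \<in> M"
      unfolding M_def by (rule closure_subset[THEN subsetD]) (use u in auto)
    then have "- u \<in> M" using C_N[OF u(1)] by simp
    then obtain b where b: "b \<in> B" "dist b (- u) < 1/2" using B(3) by auto
    then have "norm (u - (- b)) < 1/2" by (simp add: dist_norm add.commute)
    with far[OF span_neg[OF span_base[OF b(1)]]] show False by simp
  qed
  with B(1) show ?thesis by (auto simp: N_def)
qed

section \<open>Generalized inverses of left semi-Fredholm operators\<close>

lemma id_plus_compact_funpow:
  assumes C: "C \<in> bounded_operators smul" "compact_operator C"
  shows "\<exists>D\<in>bounded_operators smul. compact_operator D \<and>
    blinfun_apply (id_blinfun + C) ^^ n = blinfun_apply (id_blinfun + D)"
proof (induction n)
  case 0
  show ?case
    by (intro bexI[of _ 0]) (auto simp: compact_operator_zero bounded_operators_intros)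
next
  case (Suc n)
  then obtain D where D: "D \<in> bounded_operators smul" "compact_operator D"
    and eq: "blinfun_apply (id_blinfun + C) ^^ n = blinfun_apply (id_blinfun + D)" by blast
  have "blinfun_apply (id_blinfun + C) ^^ Suc n = blinfun_apply (id_blinfun + (D + (C + (C o\<^sub>L D))))"
    by (rule ext) (simp add: eq blinfun.bilinear_simps)
  moreover have "D + (C + (C o\<^sub>L D)) \<in> bounded_operators smul"
    by (intro bounded_operators_intros C D)
  moreover have "compact_operator (D + (C + (C o\<^sub>L D)))"
    by (intro compact_operator_add compact_operator_compose_right C D)
  ultimately show ?case by blast
qed

lemma id_plus_compact_left_inverse:
  assumes C: "C \<in> bounded_operators smul" "compact_operator C"
    and inj: "\<And>x. blinfun_apply (id_blinfun + C) x = 0 \<Longrightarrow> x = 0"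
  shows "\<exists>G\<in>bounded_operators smul. G o\<^sub>L (id_blinfun + C) = id_blinfun"
proof -
  let ?F = "blinfun_apply (id_blinfun + C)"
  have F_smul: "?F (smul c x) = smul c (?F x)" for c x
    by (intro bounded_operators_apply bounded_operators_intros C)
  have injF: "inj ?F"
    by (rule injI) (metis inj blinfun.diff_right right_minus_eq)
  have surj: "surj ?F"
    using C(2) inj by (rule id_plus_compact_surj)
  obtain c where c: "\<And>x. norm x \<le> c * norm (?F x)"
    using id_plus_compact_bounded_below[OF C(2) inj] by blast
  have F_inv: "?F (inv ?F y) = y" for y
    using surj by (rule surj_f_inv_f)
  have inv_eq: "inv ?F y = x" if "?F x = y" for x y
    using injF that by (rule inv_f_eq)
  have "bounded_linear (inv ?F)"
  proof (rule bounded_linear_intro)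
    show "norm (inv ?F y) \<le> norm y * c" for y
      using c[of "inv ?F y"] by (simp add: F_inv mult.commute)
  qed (auto intro!: inv_eq simp: blinfun.add_right blinfun.scaleR_right F_inv)
  then have G: "blinfun_apply (Blinfun (inv ?F)) = inv ?F"
    by (rule bounded_linear_Blinfun_apply)
  have "Blinfun (inv ?F) \<in> bounded_operators smul"
    unfolding bounded_operators_def mem_Collect_eq G by (auto intro!: inv_eq simp: F_smul F_inv)
  moreover have "Blinfun (inv ?F) o\<^sub>L (id_blinfun + C) = id_blinfun"
    by (intro blinfun_eqI) (simp only: blinfun_apply_blinfun_compose G inv_f_f[OF injF] blinfun_apply_id_blinfun)
  ultimately show ?thesis by blast
qed

text \<open>
  The projection \<open>P\<close> fills the kernel of the power \<open>F'\<close> of \<open>F = I + C\<close>: if \<open>F' x + P x = 0\<close>, then \<open>F' x = - P x\<close> lies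
  in the range and in the kernel of \<open>F'\<close>, so both terms vanish and \<open>x = P x = 0\<close>. Hence \<open>F' + P\<close> has an
  inverse \<open>G\<close>, and \<open>G F' = I - G P\<close> with \<open>F' = F\<^sup>n S A\<close>.
\<close>

lemma left_inverse_modulo_finite_rank:
  assumes A: "A \<in> bounded_operators smul" and S: "S \<in> bounded_operators smul"
    and C: "C \<in> bounded_operators smul" "compact_operator C"
    and SA: "S o\<^sub>L A = id_blinfun + C"
  shows "\<exists>L\<in>bounded_operators smul. \<exists>R\<in>bounded_operators smul. \<exists>B.
    L o\<^sub>L A = id_blinfun - R \<and> finite B \<and> range (blinfun_apply R) = span B"
proof -
  let ?F = "blinfun_apply (id_blinfun + C)"
  obtain n where n: "\<And>x. (?F ^^ Suc n) ((?F ^^ Suc n) x) = 0 \<Longrightarrow> (?F ^^ Suc n) x = 0"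
    using id_plus_compact_ascent[OF C(2)] by blast
  obtain H where H: "H \<in> bounded_operators smul" "?F ^^ n = blinfun_apply (id_blinfun + H)"
    using id_plus_compact_funpow[OF C] by blast
  obtain D where D: "D \<in> bounded_operators smul" "compact_operator D"
    and D_eq: "?F ^^ Suc n = blinfun_apply (id_blinfun + D)"
    using id_plus_compact_funpow[OF C] by blast
  obtain B where B: "finite B" "{x. blinfun_apply (id_blinfun + D) x = 0} = span B"
    using id_plus_compact_kernel_finite_dimensional[OF D] by blast
  obtain P where P: "P \<in> bounded_operators smul" "compact_operator P"
    and P_into: "\<And>x. blinfun_apply P x \<in> span B"
    and P_id: "\<And>x. x \<in> span B \<Longrightarrow> blinfun_apply P x = x"
    using finite_dimensional_projection[OF B(1)] by blast
  \<comment> \<open>Below, \<open>F' = I + D\<close> is the power with kernel \<open>span B\<close>, and \<open>F' + P\<close> is shown to be injective.\<close>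
  have "x = 0" if x: "blinfun_apply (id_blinfun + (D + P)) x = 0" for x
  proof -
    have eq: "blinfun_apply (id_blinfun + D) x = blinfun_apply P (- x)"
      using x by (simp add: blinfun.bilinear_simps eq_neg_iff_add_eq_0 add.assoc)
    then have "blinfun_apply (id_blinfun + D) x \<in> span B"
      using P_into by simp
    then have "blinfun_apply (id_blinfun + D) x = 0"
      using n[of x] B(2) unfolding D_eq by blast
    moreover from this have "x \<in> span B" using B(2) by blast
    ultimately show "x = 0"
      using eq P_id[of x] by (simp add: blinfun.minus_right)
  qed
  then obtain G where G: "G \<in> bounded_operators smul" "G o\<^sub>L (id_blinfun + (D + P)) = id_blinfun"
    using id_plus_compact_left_inverse[of "D + P"] bounded_operators_intros(3)[OF D(1) P(1)]
      compact_operator_add[OF D(2) P(2)] by blast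
  define L where "L = G o\<^sub>L ((id_blinfun + H) o\<^sub>L S)"
  have "L \<in> bounded_operators smul"
    unfolding L_def by (intro bounded_operators_intros G H S)
  moreover have "G o\<^sub>L P \<in> bounded_operators smul"
    by (intro bounded_operators_intros G P)
  moreover have "L o\<^sub>L A = id_blinfun - (G o\<^sub>L P)"
  proof (rule blinfun_eqI)
    fix x
    have "blinfun_apply (L o\<^sub>L A) x = blinfun_apply G ((?F ^^ n) (blinfun_apply (S o\<^sub>L A) x))"
      by (simp add: L_def H(2))
    also have "\<dots> = blinfun_apply G (blinfun_apply (id_blinfun + D) x)"
      unfolding SA by (simp only: funpow_Suc_right D_eq[symmetric] o_apply)
    also have "\<dots> = blinfun_apply (G o\<^sub>L (id_blinfun + (D + P))) x - blinfun_apply G (blinfun_apply P x)"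
      by (simp add: blinfun.bilinear_simps)
    also have "\<dots> = blinfun_apply (id_blinfun - (G o\<^sub>L P)) x"
      by (simp add: G(2) blinfun.diff_left)
    finally show "blinfun_apply (L o\<^sub>L A) x = blinfun_apply (id_blinfun - (G o\<^sub>L P)) x" .
  qed
  moreover have "range (blinfun_apply (G o\<^sub>L P)) = span (blinfun_apply G ` B)"
  proof -
    have "range (blinfun_apply P) = span B"
      using P_into P_id by (metis image_subset_iff rangeI subsetI subset_antisym)
    moreover have "range (blinfun_apply (G o\<^sub>L P)) = blinfun_apply G ` range (blinfun_apply P)"
      by auto
    ultimately show ?thesis
      by (simp only: bounded_operators_span_image[OF G(1)])
  qed
  ultimately show ?thesis using B(1) by blast
qed

text \<open>
  The left inverse \<open>L\<close> modulo finite rank leaves the defect \<open>E = A - A L A = A R\<close>. A generalized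
  inverse \<open>D\<close> of \<open>E\<close>, inserted as \<open>(I - L A) D (I - A L)\<close>, repairs it, because \<open>I - L A\<close> and \<open>I - A L\<close> turn into \<open>E\<close> when
  multiplied by \<open>A\<close> from the left and from the right, respectively.
\<close>

lemma left_semi_Fredholm_generalized_inverse:
  assumes A: "left_semi_Fredholm smul A"
  shows "\<exists>B\<in>bounded_operators smul. A o\<^sub>L B o\<^sub>L A = A"
proof -
  obtain S C where A': "A \<in> bounded_operators smul" and S: "S \<in> bounded_operators smul"
    and C: "C \<in> bounded_operators smul" "compact_operator C" "S o\<^sub>L A = id_blinfun + C"
    using A unfolding left_semi_Fredholm_def by blast
  obtain L R B where L: "L \<in> bounded_operators smul" and R: "R \<in> bounded_operators smul"
    and LA: "L o\<^sub>L A = id_blinfun - R"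
    and B: "finite B" "range (blinfun_apply R) = span B"
    using left_inverse_modulo_finite_rank[OF A' S C] by blast
  define E where "E = A o\<^sub>L R"
  have E: "E \<in> bounded_operators smul" unfolding E_def by (intro bounded_operators_intros A' R)
  have "range (blinfun_apply E) = blinfun_apply A ` range (blinfun_apply R)"
    by (auto simp: E_def)
  also have "\<dots> = span (blinfun_apply A ` B)"
    by (simp only: B(2) bounded_operators_span_image[OF A'])
  finally have range_E: "range (blinfun_apply E) = span (blinfun_apply A ` B)" .
  then have "blinfun_apply A ` B \<subseteq> range (blinfun_apply E)"
    by (simp add: span_superset)
  then obtain D where D: "D \<in> bounded_operators smul"
    and ED: "\<And>x. x \<in> span (blinfun_apply A ` B) \<Longrightarrow> blinfun_apply E (blinfun_apply D x) = x"
    using finite_dimensional_section[OF E, of "blinfun_apply A ` B"] B(1) by blast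
  have EDE: "blinfun_apply E (blinfun_apply D (blinfun_apply E x)) = blinfun_apply E x" for x
    by (rule ED) (simp flip: range_E)
  have LA_apply: "blinfun_apply L (blinfun_apply A x) = x - blinfun_apply R x" for x
    using arg_cong[OF LA, of "\<lambda>T. blinfun_apply T x"] by (simp add: blinfun.diff_left)
  \<comment> \<open>The factor \<open>R\<close> is \<open>I - L A\<close>.\<close>
  define T where "T = L + (R o\<^sub>L (D o\<^sub>L (id_blinfun - (A o\<^sub>L L))))"
  have "T \<in> bounded_operators smul"
    unfolding T_def by (intro bounded_operators_intros L R D A')
  moreover have "A o\<^sub>L T o\<^sub>L A = A"
  proof (rule blinfun_eqI)
    fix x
    have "blinfun_apply T (blinfun_apply A x) = x - blinfun_apply R x + blinfun_apply R (blinfun_apply D (blinfun_apply E x))"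
      by (simp add: T_def E_def blinfun.bilinear_simps LA_apply)
    then show "blinfun_apply (A o\<^sub>L T o\<^sub>L A) x = blinfun_apply A x"
      using EDE[of x] by (simp add: E_def blinfun.bilinear_simps)
  qed
  ultimately show ?thesis by blast
qed

lemma left_semi_Fredholm_compact_perturbation:
  assumes "left_semi_Fredholm smul T" "K \<in> bounded_operators smul" "compact_operator K"
  shows "left_semi_Fredholm smul (T + K)"
proof -
  obtain S C where T: "T \<in> bounded_operators smul" and S: "S \<in> bounded_operators smul"
    and C: "C \<in> bounded_operators smul" "compact_operator C" "S o\<^sub>L T = id_blinfun + C"
    using assms(1) unfolding left_semi_Fredholm_def by blast
  have "S o\<^sub>L (T + K) = id_blinfun + (C + (S o\<^sub>L K))"
    using C(3) by (simp add: bounded_bilinear.add_right[OF bounded_bilinear_blinfun_compose] add.assoc)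
  moreover have "C + (S o\<^sub>L K) \<in> bounded_operators smul"
    by (intro bounded_operators_intros C S assms)
  moreover have "compact_operator (C + (S o\<^sub>L K))"
    by (intro compact_operator_add compact_operator_compose_left C assms)
  ultimately show ?thesis
    unfolding left_semi_Fredholm_def using bounded_operators_intros(3)[OF T assms(2)] S by blast
qed

end

section \<open>Complements from generalized inverses\<close>

context banach_space_over
begin

lemma closed_subspace_of_kernel:
  assumes "T \<in> bounded_operators smul" "subspace Y"
  shows "closed_subspace_of smul Y {y \<in> Y. blinfun_apply T y = 0}"
proof -
  have "{y \<in> Y. blinfun_apply T y = 0} = Y \<inter> {y. blinfun_apply T y = 0}" by blast
  moreover have "closed {y. blinfun_apply T y = 0}"
    by (intro closed_Collect_eq continuous_intros)
  ultimately show ?thesis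
    using assms(2) subspace_kernel_bounded_operators[OF assms(1)]
    by (simp add: closed_subspace_of_def closedin_closed_Int subspace_inter)
qed

text \<open>
  The range of \<open>Q\<close> on \<open>Y\<close> is the kernel of \<open>I - Q\<close>, hence closed; \<open>y = Q y + (y - Q y)\<close> is the decomposition.
  Here \<open>Q\<close> acts on the whole space and is idempotent only on the invariant subspace \<open>Y\<close>; this is the form
  that fits the dual space, which may be a proper subspace of its ambient type.
\<close>

lemma complemented_projection:
  assumes Q: "Q \<in> bounded_operators smul" and Y: "subspace Y"
    and QY: "\<And>y. y \<in> Y \<Longrightarrow> blinfun_apply Q y \<in> Y"
    and idem: "\<And>y. y \<in> Y \<Longrightarrow> blinfun_apply Q (blinfun_apply Q y) = blinfun_apply Q y"
  shows "complemented_subspace_of smul Y (blinfun_apply Q ` Y)"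
    and "complemented_subspace_of smul Y {y \<in> Y. blinfun_apply Q y = 0}"
proof -
  let ?N = "{y \<in> Y. blinfun_apply Q y = 0}"
  have image: "blinfun_apply Q ` Y = {y \<in> Y. blinfun_apply (id_blinfun - Q) y = 0}"
    using QY idem by (force simp: blinfun.diff_left)
  have closed: "closed_subspace_of smul Y (blinfun_apply Q ` Y)" "closed_subspace_of smul Y ?N"
    unfolding image by (intro closed_subspace_of_kernel bounded_operators_intros Q Y)+
  have "y \<in> {x + z |x z. x \<in> blinfun_apply Q ` Y \<and> z \<in> ?N}" if "y \<in> Y" for y
  proof -
    have "y - blinfun_apply Q y \<in> ?N"
      using that QY idem Y by (auto simp: blinfun.diff_right intro: subspace_diff)
    moreover have "y = blinfun_apply Q y + (y - blinfun_apply Q y)" by simp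
    ultimately show ?thesis using that by blast
  qed
  then have sum: "{x + z |x z. x \<in> blinfun_apply Q ` Y \<and> z \<in> ?N} = Y"
    using QY Y by (auto intro: subspace_add)
  then have sum': "{x + z |x z. x \<in> ?N \<and> z \<in> blinfun_apply Q ` Y} = Y"
    by (subst (asm) add.commute) blast
  have int: "blinfun_apply Q ` Y \<inter> ?N = {0}"
    using idem subspace_0[OF Y] by (force simp: image_iff blinfun.zero_right)
  then have int': "?N \<inter> blinfun_apply Q ` Y = {0}"
    by (subst Int_commute)
  show "complemented_subspace_of smul Y (blinfun_apply Q ` Y)"
    unfolding complemented_subspace_of_def using closed sum int by blast
  show "complemented_subspace_of smul Y ?N"
    unfolding complemented_subspace_of_def using closed sum' int' by blast
qed

text \<open>
  If \<open>A B A = A\<close>, then \<open>A B\<close> and \<open>B A\<close> are idempotent, \<open>A B\<close> has the range of \<open>A\<close>, and \<open>B A\<close> has the kernel of \<open>A\<close>.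
\<close>

lemma generalized_inverse_complemented:
  assumes A: "A \<in> bounded_operators smul" and B: "B \<in> bounded_operators smul" and Y: "subspace Y"
    and AY: "\<And>y. y \<in> Y \<Longrightarrow> blinfun_apply A y \<in> Y"
    and BY: "\<And>y. y \<in> Y \<Longrightarrow> blinfun_apply B y \<in> Y"
    and ABA: "A o\<^sub>L B o\<^sub>L A = A"
  shows "complemented_subspace_of smul Y (blinfun_apply A ` Y)"
    and "complemented_subspace_of smul Y {y \<in> Y. blinfun_apply A y = 0}"
    and "closedin (top_of_set Y) (blinfun_apply A ` Y)"
proof -
  have ABA_apply: "blinfun_apply A (blinfun_apply B (blinfun_apply A y)) = blinfun_apply A y" for y
    using arg_cong[OF ABA, of "\<lambda>T. blinfun_apply T y"] by simp
  have "blinfun_apply A ` Y = blinfun_apply (A o\<^sub>L B) ` Y"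
  proof
    show "blinfun_apply A ` Y \<subseteq> blinfun_apply (A o\<^sub>L B) ` Y"
    proof
      fix x assume "x \<in> blinfun_apply A ` Y"
      then obtain y where "y \<in> Y" "x = blinfun_apply A y" by blast
      then have "x = blinfun_apply (A o\<^sub>L B) (blinfun_apply A y)"
        by (simp add: ABA_apply)
      with AY[OF \<open>y \<in> Y\<close>] show "x \<in> blinfun_apply (A o\<^sub>L B) ` Y" by blast
    qed
    show "blinfun_apply (A o\<^sub>L B) ` Y \<subseteq> blinfun_apply A ` Y"
      using BY by auto
  qed
  then show range: "complemented_subspace_of smul Y (blinfun_apply A ` Y)"
    using complemented_projection(1)[of "A o\<^sub>L B" Y] A B Y AY BY
    by (simp add: bounded_operators_intros ABA_apply)
  have "{y \<in> Y. blinfun_apply A y = 0} = {y \<in> Y. blinfun_apply (B o\<^sub>L A) y = 0}"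
  proof (intro Collect_cong conj_cong refl iffI)
    fix y assume "blinfun_apply (B o\<^sub>L A) y = 0"
    then show "blinfun_apply A y = 0"
      using ABA_apply[of y] by (simp add: blinfun.zero_right)
  qed (simp add: blinfun.zero_right)
  then show "complemented_subspace_of smul Y {y \<in> Y. blinfun_apply A y = 0}"
    using complemented_projection(2)[of "B o\<^sub>L A" Y] A B Y AY BY
    by (simp add: bounded_operators_intros ABA_apply)
  show "closedin (top_of_set Y) (blinfun_apply A ` Y)"
    using range by (simp add: complemented_subspace_of_def closed_subspace_of_def)
qed

end

lemma blinfun_apply_adjoint:
  "blinfun_apply (Blinfun (adjoint_operator T)) = adjoint_operator T"
  unfolding adjoint_operator_def
  by (intro bounded_linear_Blinfun_apply
      bounded_bilinear.bounded_linear_left[OF bounded_bilinear_blinfun_compose])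

theorem corollary5p3:
  fixes smul :: "'k::{real_normed_field,euclidean_space} \<Rightarrow> 'a::banach \<Rightarrow> 'a"
    and T K :: "'a \<Rightarrow>\<^sub>L 'a"
  assumes "banach_space_over smul"
    and "T \<in> bounded_operators smul"
    and "K \<in> bounded_operators smul"
    and "left_semi_Fredholm smul T"
    and "compact_operator K"
  shows "complemented_subspace_of smul UNIV (closure (range (blinfun_apply (T + K)))) \<and>
     complemented_subspace_of smul UNIV {x. blinfun_apply (T + K) x = 0} \<and>
     complemented_subspace_of dual_scale (dual_space smul)
           (closure ((\<lambda>f. adjoint_operator T f + adjoint_operator K f) ` dual_space smul)) \<and>
     complemented_subspace_of dual_scale (dual_space smul)
           {f \<in> dual_space smul. adjoint_operator T f + adjoint_operator K f = 0} \<and>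
     closed (range (blinfun_apply (T + K))) \<and>
     closedin (top_of_set (dual_space smul))
           ((\<lambda>f. adjoint_operator T f + adjoint_operator K f) ` dual_space smul)"
proof -
  interpret X: banach_space_over smul by (rule assms(1))
  interpret dual: banach_space_over "dual_scale :: 'k \<Rightarrow> ('a \<Rightarrow>\<^sub>L 'k) \<Rightarrow> _"
    by (rule banach_space_over_dual_scale)
  define A where "A = T + K"
  have A: "A \<in> bounded_operators smul"
    unfolding A_def by (intro X.bounded_operators_intros assms)
  obtain B where B: "B \<in> bounded_operators smul" and ABA: "A o\<^sub>L B o\<^sub>L A = A"
    using X.left_semi_Fredholm_generalized_inverse[OF
        X.left_semi_Fredholm_compact_perturbation[OF assms(4,3,5)]]
    unfolding A_def by blast
  note space = X.generalized_inverse_complemented[OF A B X.subspace_UNIV UNIV_I UNIV_I ABA]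

  define adj :: "('a \<Rightarrow>\<^sub>L 'a) \<Rightarrow> (('a \<Rightarrow>\<^sub>L 'k) \<Rightarrow>\<^sub>L ('a \<Rightarrow>\<^sub>L 'k))"
    where "adj S = Blinfun (adjoint_operator S)" for S
  have adj: "blinfun_apply (adj S) = adjoint_operator S" for S
    unfolding adj_def by (rule blinfun_apply_adjoint)
  have adj_linear: "adj S \<in> bounded_operators dual_scale" for S
    by (auto simp: bounded_operators_def adj adjoint_operator_def dual_scale_apply intro: blinfun_eqI)
  have adj_dual: "blinfun_apply (adj S) f \<in> dual_space smul"
    if "S \<in> bounded_operators smul" "f \<in> dual_space smul" for S f
    unfolding adj using that by (rule adjoint_operator_in_dual_space)
  have "adj A o\<^sub>L adj B o\<^sub>L adj A = adj (A o\<^sub>L B o\<^sub>L A)"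
    by (intro blinfun_eqI) (simp add: adj adjoint_operator_def)
  then have adj_ABA: "adj A o\<^sub>L adj B o\<^sub>L adj A = adj A" by (simp add: ABA)
  note dual = dual.generalized_inverse_complemented[OF adj_linear adj_linear subspace_dual_space
      adj_dual[OF A] adj_dual[OF B] adj_ABA]
  have sum: "adjoint_operator T f + adjoint_operator K f = blinfun_apply (adj A) f" for f
    by (simp add: adj A_def adjoint_operator_def
        bounded_bilinear.add_right[OF bounded_bilinear_blinfun_compose])
  have closed: "closed (range (blinfun_apply A))"
    using space(3) by (simp only: closed_closedin subtopology_UNIV)
  have adj_closed: "closed (blinfun_apply (adj A) ` dual_space smul)"
    using dual(3) closed_dual_space by (rule closedin_closed_trans)
  have kernel: "{x \<in> UNIV. blinfun_apply A x = 0} = {x. blinfun_apply A x = 0}"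
    by simp
  show ?thesis
    unfolding sum A_def[symmetric] closure_closed[OF closed] closure_closed[OF adj_closed]
    using space(1) space(2)[unfolded kernel] closed dual by blast
qed

end
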